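(* Let $q$ be a sufficiently large prime power and let $\mathcal{N}\subseteq\mathbb{F}_q^3$ be a Nikodym set. Then $|\mathcal{N}|\geq 0.38\,q^3$.
   Context: $\mathbb{F}_q$ denotes the finite field with $q$ elements; a line in $\mathbb{F}_q^n$ is a one-dimensional affine subspace. A Nikodym set $\mathcal{N}\subseteq\mathbb{F}_q^n$ is a set of points such that through every point $p\in\mathbb{F}_q^n$ there is a line $\ell$ with $\ell\setminus\{p\}\subseteq\mathcal{N}$. *)

theory Defs
  imports Complex_Main "HOL-Library.FuncSet" "HOL-Algebra.Ring" "HOL-Algebra.Coset"
begin

text \<open>
  Fields are records with an explicit carrier rather than types of class \<open>field\<close>:
  a bound "for all sufficiently large finite fields" has to be chosen before the field, and HOL
  cannot quantify over types inside a formula. Every finite field is isomorphic to one whose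
  carrier is a set of natural numbers, so such a bound for the element type \<open>nat\<close> is a bound for
  all finite fields. Points of \<open>F^n\<close> are the extensional
  functions from \<open>{..<n}\<close> to the carrier, so that equality of functions is equality of points.
\<close>

definition aff_space :: "('a, 'm) ring_scheme \<Rightarrow> nat \<Rightarrow> (nat \<Rightarrow> 'a) set" where
  "aff_space F n = {..<n} \<rightarrow>\<^sub>E carrier F"

definition zero_vector :: "('a, 'm) ring_scheme \<Rightarrow> nat \<Rightarrow> nat \<Rightarrow> 'a" where
  "zero_vector F n = (\<lambda>i\<in>{..<n}. \<zero>\<^bsub>F\<^esub>)"

definition vector_add ::
    "('a, 'm) ring_scheme \<Rightarrow> nat \<Rightarrow> (nat \<Rightarrow> 'a) \<Rightarrow> (nat \<Rightarrow> 'a) \<Rightarrow> nat \<Rightarrow> 'a" where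
  "vector_add F n u v = (\<lambda>i\<in>{..<n}. u i \<oplus>\<^bsub>F\<^esub> v i)"

definition vector_scale ::
    "('a, 'm) ring_scheme \<Rightarrow> nat \<Rightarrow> 'a \<Rightarrow> (nat \<Rightarrow> 'a) \<Rightarrow> nat \<Rightarrow> 'a" where
  "vector_scale F n t v = (\<lambda>i\<in>{..<n}. t \<otimes>\<^bsub>F\<^esub> v i)"

text \<open>A one-dimensional affine subspace is a translate of the span of a nonzero vector.\<close>

definition is_line :: "('a, 'm) ring_scheme \<Rightarrow> nat \<Rightarrow> (nat \<Rightarrow> 'a) set \<Rightarrow> bool" where
  "is_line F n l \<longleftrightarrow>
     (\<exists>a\<in>aff_space F n. \<exists>v\<in>aff_space F n. v \<noteq> zero_vector F n \<and>
        l = (\<lambda>t. vector_add F n a (vector_scale F n t v)) ` carrier F)"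

definition nikodym_set :: "('a, 'm) ring_scheme \<Rightarrow> nat \<Rightarrow> (nat \<Rightarrow> 'a) set \<Rightarrow> bool" where
  "nikodym_set F n N \<longleftrightarrow>
     N \<subseteq> aff_space F n \<and>
     (\<forall>p\<in>aff_space F n. \<exists>l. is_line F n l \<and> p \<in> l \<and> l - {p} \<subseteq> N)"

end

(*
  Let C be the complement of the Nikodym set N and n = |C|. Each p in C has a tangent, a line that
  meets C in p alone, and the n tangents are distinct. They have n(q-1) incidences with the points
  of N, so by Cauchy-Schwarz at least about n^2 q^2 / |N| ordered pairs of them intersect.
  Intersecting tangents are coplanar, so the number of pairs is at most the sum of d^2 over
  all planes, where d is the number of tangents in the plane. If the plane contains c points of C,
  then its lines meet C in c/q points on average with small variance, while tangents meet it in
  one point; this forces d <= (1 + o(1)) q^3 / c. A second variance computation, over all planes,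
  gives c >= (1 - o(1)) n/q outside O(q) planes, whose contribution is negligible. As the sum
  of d is n(q+1), the sum of d^2 is at most (1 + o(1)) q^5. Comparing, n^2 <= (1 + o(1)) q^3 |N|,
  so the density v of N satisfies (1-v)^2 <= v + o(1), that is v >= (3 - sqrt 5)/2 - o(1), which
  exceeds 0.38.
*)

theory Submission imports Defs "HOL-Analysis.Convex" begin

section \<open>Double counting and second moments\<close>

lemma real_card_filter:
  "finite A \<Longrightarrow> real (card {x\<in>A. P x}) = (\<Sum>x\<in>A. of_bool (P x))"
  by (simp add: of_bool_def sum.If_cases Int_def)

lemma sum_card_filter:
  assumes "finite I" "finite C"
  shows "(\<Sum>i\<in>I. real (card {x\<in>C. R i x})) = (\<Sum>x\<in>C. real (card {i\<in>I. R i x}))"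
proof -
  have "(\<Sum>i\<in>I. real (card {x\<in>C. R i x})) = (\<Sum>i\<in>I. \<Sum>x\<in>C. of_bool (R i x))"
    using assms by (simp only: real_card_filter)
  also have "\<dots> = (\<Sum>x\<in>C. \<Sum>i\<in>I. of_bool (R i x))"
    by (rule sum.swap)
  finally show ?thesis
    using assms by (simp only: real_card_filter)
qed

text \<open>A squared count is a count of ordered pairs, diagonal included, so exchanging the sums
  turns it into joint incidences.\<close>

lemma sum_card_filter_squared:
  assumes "finite I" "finite C"
  shows "(\<Sum>i\<in>I. (real (card {x\<in>C. R i x}))\<^sup>2)
    = (\<Sum>x\<in>C. \<Sum>y\<in>C. real (card {i\<in>I. R i x \<and> R i y}))"
proof -
  have "(\<Sum>i\<in>I. (real (card {x\<in>C. R i x}))\<^sup>2)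
      = (\<Sum>i\<in>I. \<Sum>x\<in>C. \<Sum>y\<in>C. of_bool (R i x \<and> R i y))"
    using assms by (simp only: real_card_filter power2_eq_square sum_product of_bool_conj)
  also have "\<dots> = (\<Sum>x\<in>C. \<Sum>i\<in>I. \<Sum>y\<in>C. of_bool (R i x \<and> R i y))"
    by (rule sum.swap)
  also have "\<dots> = (\<Sum>x\<in>C. \<Sum>y\<in>C. \<Sum>i\<in>I. of_bool (R i x \<and> R i y))"
    by (intro sum.cong refl sum.swap)
  finally show ?thesis
    using assms by (simp only: real_card_filter)
qed

text \<open>Expanding the square gives a sum over ordered pairs of points, where a diagonal pair
  contributes \<open>r\<close> and any other pair \<open>l\<close>. It is applied to planes in space
  and to lines in a plane, with \<mu> the mean.\<close>

lemma second_moment: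
  fixes r l \<mu> :: real
  assumes "finite I" "finite C"
    and r: "\<And>x. x \<in> C \<Longrightarrow> real (card {i\<in>I. R i x}) = r"
    and l: "\<And>x y. x \<in> C \<Longrightarrow> y \<in> C \<Longrightarrow> x \<noteq> y \<Longrightarrow> real (card {i\<in>I. R i x \<and> R i y}) = l"
  shows "(\<Sum>i\<in>I. (real (card {x\<in>C. R i x}) - \<mu>)\<^sup>2)
    = card C * r + card C * (real (card C) - 1) * l - 2 * \<mu> * card C * r + \<mu>\<^sup>2 * card I"
proof -
  have 1: "(\<Sum>i\<in>I. real (card {x\<in>C. R i x})) = card C * r"
    using assms by (simp add: sum_card_filter)
  have "(\<Sum>i\<in>I. (real (card {x\<in>C. R i x}))\<^sup>2)
      = (\<Sum>x\<in>C. \<Sum>y\<in>C. real (card {i\<in>I. R i x \<and> R i y}))"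
    using assms(1,2) by (rule sum_card_filter_squared)
  also have "\<dots> = (\<Sum>x\<in>C. r + (real (card C) - 1) * l)"
  proof (rule sum.cong[OF refl])
    fix x assume x: "x \<in> C"
    have "(\<Sum>y\<in>C. real (card {i\<in>I. R i x \<and> R i y}))
        = r + (\<Sum>y\<in>C-{x}. real (card {i\<in>I. R i x \<and> R i y}))"
      using x assms(2) r[OF x] by (subst sum.remove[of _ x]) auto
    also have "(\<Sum>y\<in>C-{x}. real (card {i\<in>I. R i x \<and> R i y})) = (\<Sum>y\<in>C-{x}. l)"
      using x by (intro sum.cong l) auto
    also have "\<dots> = (real (card C) - 1) * l"
    proof -
      have "card C = Suc (card (C - {x}))"
        using x assms(2) by (metis card_Suc_Diff1)
      then show ?thesis by simp
    qed
    finally show "(\<Sum>y\<in>C. real (card {i\<in>I. R i x \<and> R i y})) = r + (real (card C) - 1) * l" .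
  qed
  finally have 2: "(\<Sum>i\<in>I. (real (card {x\<in>C. R i x}))\<^sup>2) = card C * r + card C * (real (card C) - 1) * l"
    by (simp add: algebra_simps)
  have "(\<Sum>i\<in>I. (real (card {x\<in>C. R i x}) - \<mu>)\<^sup>2)
      = (\<Sum>i\<in>I. (real (card {x\<in>C. R i x}))\<^sup>2) - 2 * \<mu> * (\<Sum>i\<in>I. real (card {x\<in>C. R i x})) + \<mu>\<^sup>2 * card I"
    by (simp add: power2_diff sum.distrib sum_subtractf sum_distrib_left algebra_simps)
  then show ?thesis
    unfolding 1 2 by (simp add: algebra_simps)
qed

section \<open>Abstract planes and lines: variances and tangents in a plane\<close>

text \<open>Planes and lines are index sets, so that they can be listed with multiplicity: in the model
  below, a plane is given by an equation and occurs \<open>q - 1\<close> times, and a line is given by a base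
  point and a direction and occurs \<open>q * (q - 1)\<close> times. The counts below include these factors.\<close>

locale affine_3space =
  fixes V :: "'p set" and q :: nat
    and Pl :: "'i set" and S :: "'i \<Rightarrow> 'p set"
    and Li :: "'j set" and T :: "'j \<Rightarrow> 'p set"
  assumes q_ge_2: "q \<ge> 2"
    and finite_V: "finite V" and card_V: "card V = q ^ 3"
    and finite_Pl: "finite Pl" and card_Pl: "real (card Pl) = real q * (real q ^ 3 - 1)"
    and finite_Li: "finite Li"
    and line_subset: "j \<in> Li \<Longrightarrow> T j \<subseteq> V"
    and card_line: "j \<in> Li \<Longrightarrow> card (T j) = q"
    and line_unique: "\<lbrakk>j \<in> Li; k \<in> Li; x \<in> T j; x \<in> T k; y \<in> T j; y \<in> T k; x \<noteq> y\<rbrakk> \<Longrightarrow> T j = T k"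
    and line_in_plane: "\<lbrakk>i \<in> Pl; j \<in> Li; x \<in> T j; y \<in> T j; x \<noteq> y; x \<in> S i; y \<in> S i\<rbrakk> \<Longrightarrow> T j \<subseteq> S i"
    and planes_point: "x \<in> V \<Longrightarrow> real (card {i\<in>Pl. x \<in> S i}) = real q ^ 3 - 1"
    and planes_2points: "\<lbrakk>x \<in> V; y \<in> V; x \<noteq> y\<rbrakk> \<Longrightarrow>
      real (card {i\<in>Pl. x \<in> S i \<and> y \<in> S i}) = real q ^ 2 - 1"
    and planes_3points: "\<lbrakk>x \<in> V; y \<in> V; z \<in> V\<rbrakk> \<Longrightarrow>
      real (card {i\<in>Pl. x \<in> S i \<and> y \<in> S i \<and> z \<in> S i}) \<ge> real q - 1"
    and lines_plane: "i \<in> Pl \<Longrightarrow> real (card {j\<in>Li. T j \<subseteq> S i}) = real q ^ 2 * (real q ^ 2 - 1)"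
    and lines_point: "\<lbrakk>i \<in> Pl; x \<in> V; x \<in> S i\<rbrakk> \<Longrightarrow>
      real (card {j\<in>Li. T j \<subseteq> S i \<and> x \<in> T j}) = real q * (real q ^ 2 - 1)"
    and lines_2points: "\<lbrakk>x \<in> V; y \<in> V; x \<noteq> y\<rbrakk> \<Longrightarrow>
      real (card {j\<in>Li. x \<in> T j \<and> y \<in> T j}) = real q * (real q - 1)"
begin

text \<open>Each point lies in a fraction \<open>1 / q\<close> of the listed planes, so
  \<open>card C / q\<close> is the exact mean. The terms quadratic in \<open>card C\<close> nearly
  cancel and leave a negative remainder, which is dropped.\<close>

lemma plane_variance:
  assumes "C \<subseteq> V"
  shows "(\<Sum>i\<in>Pl. (real (card {x\<in>C. x \<in> S i}) - card C / q)\<^sup>2) \<le> real (card C) * real q ^ 3"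
proof -
  have fC: "finite C" using assms finite_V finite_subset by blast
  have "(\<Sum>i\<in>Pl. (real (card {x\<in>C. x \<in> S i}) - card C / q)\<^sup>2) = 
     card C * (real q^3 - 1) + card C * (real (card C) - 1) * (real q ^ 2 - 1)
      - 2 * (card C / q) * card C * (real q^3 - 1) + (card C / q)\<^sup>2 * card Pl"
    by (rule second_moment) (use assms finite_Pl fC in \<open>auto intro: planes_point planes_2points\<close>)
  also have "\<dots> = card C * (real q ^ 3 - real q ^ 2) - (real (card C))\<^sup>2 * (1 - 1 / q)"
    unfolding card_Pl using q_ge_2 by (simp add: field_simps power2_eq_square power3_eq_cube)
  also have "\<dots> \<le> card C * real q ^ 3"
  proof -
    have "0 \<le> (real (card C))\<^sup>2 * (1 - 1 / q)" "0 \<le> card C * real q ^ 2"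
      using q_ge_2 by auto
    moreover have "card C * (real q ^ 3 - real q ^ 2) = card C * real q ^ 3 - card C * real q ^ 2"
      by (rule right_diff_distrib)
    ultimately show ?thesis by linarith
  qed
  finally show ?thesis .
qed

text \<open>The analogue inside one plane: a point of the plane lies on a fraction
  \<open>1 / q\<close> of its lines, so \<open>c / q\<close> is the exact mean, and the quadratic
  remainder is again negative.\<close>

lemma line_variance:
  assumes "C \<subseteq> V" "i \<in> Pl" and c: "c = real (card {x\<in>C. x \<in> S i})"
  shows "(\<Sum>j\<in>{j\<in>Li. T j \<subseteq> S i}. (real (card {x\<in>{x\<in>C. x \<in> S i}. x \<in> T j}) - c / q)\<^sup>2)
    \<le> c * real q ^ 2 * (real q - 1)"
proof -
  have fC: "finite C" using assms finite_V finite_subset by blast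
  have eq: "{j\<in>{j\<in>Li. T j \<subseteq> S i}. x \<in> T j \<and> y \<in> T j} = {j\<in>Li. x \<in> T j \<and> y \<in> T j}"
    if "x \<in> S i" "y \<in> S i" "x \<noteq> y" for x y
    using that line_in_plane[OF assms(2)] by blast
  have "(\<Sum>j\<in>{j\<in>Li. T j \<subseteq> S i}. (real (card {x\<in>{x\<in>C. x \<in> S i}. x \<in> T j}) - c / q)\<^sup>2) =
     c * (real q * (real q^2 - 1)) + c * (c - 1) * (real q * (real q - 1))
      - 2 * (c / q) * c * (real q * (real q^2 - 1)) + (c / q)\<^sup>2 * card {j\<in>Li. T j \<subseteq> S i}"
    unfolding c
  proof (rule second_moment)
    fix x assume "x \<in> {x \<in> C. x \<in> S i}"
    then show "real (card {j \<in> {j\<in>Li. T j \<subseteq> S i}. x \<in> T j}) = real q * (real q^2 - 1)"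
      using lines_point[OF assms(2), of x] assms(1) by (auto simp: conj_assoc)
  next
    fix x y assume "x \<in> {x \<in> C. x \<in> S i}" "y \<in> {x \<in> C. x \<in> S i}" "x \<noteq> y"
    then show "real (card {j\<in>{j\<in>Li. T j \<subseteq> S i}. x \<in> T j \<and> y \<in> T j}) = real q * (real q - 1)"
      using lines_2points[of x y] assms(1) by (subst eq) auto
  qed (use fC finite_Li in auto)
  also have "\<dots> = c * real q ^ 2 * (real q - 1) - c\<^sup>2 * (real q - 1)"
    unfolding lines_plane[OF assms(2)] using q_ge_2
    by (simp add: field_simps power2_eq_square power3_eq_cube)
  also have "\<dots> \<le> c * real q ^ 2 * (real q - 1)"
    using q_ge_2 by auto
  finally show ?thesis .
qed

lemma ex_other_point:
  assumes "j \<in> Li"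
  shows "\<exists>y\<in>T j. y \<noteq> x"
proof (rule ccontr)
  assume "\<not> ?thesis"
  then have "T j \<subseteq> {x}" by auto
  then have "card (T j) \<le> 1" using card_mono[of "{x}" "T j"] by simp
  then show False using card_line[OF assms] q_ge_2 by simp
qed

text \<open>A plane contains the line as soon as it contains two of its points.\<close>

lemma planes_line:
  assumes "j \<in> Li"
  shows "real (card {i\<in>Pl. T j \<subseteq> S i}) = real q ^ 2 - 1"
proof -
  obtain x y where xy: "x \<in> T j" "y \<in> T j" "x \<noteq> y"
    using ex_other_point[OF assms] by metis
  have "{i\<in>Pl. T j \<subseteq> S i} = {i\<in>Pl. x \<in> S i \<and> y \<in> S i}"
    using xy line_in_plane[OF _ assms xy] by blast
  then show ?thesis
    using planes_2points[of x y] xy line_subset[OF assms] by auto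
qed

text \<open>This is the multiplicity with which every line is listed: two of its points determine
  it.\<close>

lemma lines_equal:
  assumes "j \<in> Li"
  shows "real (card {k\<in>Li. T k = T j}) = real q * (real q - 1)"
proof -
  obtain x y where xy: "x \<in> T j" "y \<in> T j" "x \<noteq> y"
    using ex_other_point[OF assms] by metis
  have "{k\<in>Li. T k = T j} = {k\<in>Li. x \<in> T k \<and> y \<in> T k}"
    using xy line_unique[OF _ assms, of _ x y] by blast
  then show ?thesis
    using lines_2points[of x y] xy line_subset[OF assms] by auto
qed

text \<open>The common point and one further point on each line determine which planes contain both
  lines. The two lines may coincide, hence an inequality.\<close>

lemma planes_meeting_lines:
  assumes "j \<in> Li" "k \<in> Li" "x \<in> T j" "x \<in> T k"
  shows "real (card {i\<in>Pl. T j \<subseteq> S i \<and> T k \<subseteq> S i}) \<ge> real q - 1"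
proof -
  obtain y z where yz: "y \<in> T j" "y \<noteq> x" "z \<in> T k" "z \<noteq> x"
    using assms ex_other_point by metis
  have "real q - 1 \<le> real (card {i\<in>Pl. x \<in> S i \<and> y \<in> S i \<and> z \<in> S i})"
    by (rule planes_3points) (use assms yz line_subset in auto)
  also have "{i\<in>Pl. x \<in> S i \<and> y \<in> S i \<and> z \<in> S i} = {i\<in>Pl. T j \<subseteq> S i \<and> T k \<subseteq> S i}"
    using assms yz line_in_plane[of _ j x y] line_in_plane[of _ k x z] by blast
  finally show ?thesis .
qed


text \<open>A tangent meets \<open>C\<close> once, whereas an average line of the plane meets it
  \<open>c / q\<close> times. Each of the \<open>d\<close> tangents therefore adds
  \<open>(1 - c / q)\<^sup>2\<close> per listing to the line variance, which is bounded by
  \<open>line_variance\<close>.\<close>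

lemma pencil_bound:
  assumes "C \<subseteq> V" "i \<in> Pl"
    and c: "c = real (card {x\<in>C. x \<in> S i})"
    and f: "\<And>x. x \<in> C \<Longrightarrow> f x \<in> Li" "\<And>x. x \<in> C \<Longrightarrow> T (f x) \<inter> C = {x}"
    and d: "d = real (card {x\<in>C. T (f x) \<subseteq> S i})"
  shows "d * (c - real q)\<^sup>2 \<le> c * real q ^ 3"
proof -
  define D where "D = {x\<in>C. T (f x) \<subseteq> S i}"
  define L where "L x = {k\<in>Li. T k = T (f x)}" for x
  have fC: "finite C" using assms finite_V finite_subset by blast
  have card_L: "real (card (L x)) = real q * (real q - 1)" if "x \<in> C" for x
    unfolding L_def using lines_equal[OF f(1)[OF that]] .
  \<comment> \<open>A tangent determines its point of contact, so tangents at different points are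
    different lines.\<close>
  have disj: "L x \<inter> L y = {}" if "x \<in> C" "y \<in> C" "x \<noteq> y" for x y
    using f(2)[of x] f(2)[of y] that unfolding L_def by auto
  have one: "card {y\<in>{y\<in>C. y \<in> S i}. y \<in> T k} = 1" if "x \<in> D" "k \<in> L x" for x k
  proof -
    have "{y\<in>{y\<in>C. y \<in> S i}. y \<in> T k} = T (f x) \<inter> C"
      using that unfolding L_def D_def by auto
    then show ?thesis using f(2)[of x] that unfolding D_def by simp
  qed
  \<comment> \<open>Every tangent is listed \<open>q * (q - 1)\<close> times, and each listing has
    the same deviation from the mean.\<close>
  have "d * (real q * (real q - 1)) * (1 - c / q)\<^sup>2 = (\<Sum>x\<in>D. real (card (L x)) * (1 - c / q)\<^sup>2)"
    using card_L by (simp add: d D_def)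
  also have "\<dots> = (\<Sum>x\<in>D. \<Sum>k\<in>L x. (real (card {y\<in>{y\<in>C. y \<in> S i}. y \<in> T k}) - c / q)\<^sup>2)"
    by (intro sum.cong refl) (simp add: one del: mem_Collect_eq)
  also have "\<dots> = (\<Sum>k\<in>(\<Union>x\<in>D. L x). (real (card {y\<in>{y\<in>C. y \<in> S i}. y \<in> T k}) - c / q)\<^sup>2)"
    by (rule sum.UNION_disjoint[symmetric]) (use fC finite_Li disj in \<open>auto simp: D_def L_def\<close>)
  also have "\<dots> \<le> (\<Sum>k\<in>{j\<in>Li. T j \<subseteq> S i}. (real (card {y\<in>{y\<in>C. y \<in> S i}. y \<in> T k}) - c / q)\<^sup>2)"
    by (rule sum_mono2) (use finite_Li in \<open>auto simp: D_def L_def\<close>)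
  also have "\<dots> \<le> c * real q ^ 2 * (real q - 1)"
    by (rule line_variance[OF assms(1,2) c])
  finally have "(real q - 1) * (d * q * (1 - c / q)\<^sup>2) \<le> (real q - 1) * (c * real q ^ 2)"
    by (simp only: mult_ac)
  then have *: "d * q * (1 - c / q)\<^sup>2 \<le> c * real q ^ 2"
    using q_ge_2 by (subst (asm) mult_le_cancel_left_pos) auto
  have "(c - real q)\<^sup>2 = real q ^ 2 * (1 - c / q)\<^sup>2"
    using q_ge_2 by (simp add: field_simps power2_eq_square)
  then have "d * (c - real q)\<^sup>2 = q * (d * q * (1 - c / q)\<^sup>2)"
    by (simp add: power2_eq_square)
  also have "\<dots> \<le> q * (c * real q ^ 2)"
    using * by (intro mult_left_mono) auto
  finally show ?thesis
    by (simp add: power2_eq_square power3_eq_cube mult_ac)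
qed

text \<open>A tangent lying in the plane has its point of contact there.\<close>

lemma pencil_le:
  assumes "C \<subseteq> V"
    and f: "\<And>x. x \<in> C \<Longrightarrow> T (f x) \<inter> C = {x}"
  shows "card {x\<in>C. T (f x) \<subseteq> S i} \<le> card {x\<in>C. x \<in> S i}"
  using finite_subset[OF assms(1) finite_V] f by (intro card_mono) auto

end

section \<open>Numerical consequences of the bound for one plane\<close>

text \<open>Here \<open>c\<close> counts the points of a tangent set in a plane and \<open>d\<close> the chosen tangents in it.
  The threshold \<open>123/200 = 0.615\<close> lies between \<open>0.38/0.62 = 0.6129...\<close> and \<open>0.62\<close>, and
  \<open>1229/2000\<close> loses another \<open>0.0005\<close> to absorb the lower order terms.\<close>

lemma pencil_bound_dense:
  fixes c d q :: real
  assumes "d * (c - q)\<^sup>2 \<le> c * q ^ 3" "c \<ge> 123 / 200 * q ^ 2" "q \<ge> 5000" "d \<ge> 0"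
  shows "d \<le> 2000 / 1229 * q"
proof -
  have q2: "5000 * q \<le> q ^ 2"
    unfolding power2_eq_square using assms(3) by (intro mult_right_mono) auto
  have c0: "c > 0" using assms(2,3) q2 by linarith
  have qc: "q \<le> 1 / 2500 * c" using q2 c0 assms(2) by linarith
  \<comment> \<open>Dropping \<open>q\<^sup>2\<close> from \<open>(c - q)\<^sup>2\<close> leaves
    \<open>c * (c - 2 * q)\<close>, and \<open>2 * q\<close> is at most
    \<open>c / 1250\<close>.\<close>
  have "c * (1249 / 1250 * c) \<le> c * (c - 2 * q)"
    using c0 qc by (intro mult_left_mono) auto
  also have "\<dots> \<le> (c - q)\<^sup>2"
    by (simp add: power2_eq_square algebra_simps)
  finally have "d * (c * (1249 / 1250 * c)) \<le> d * (c - q)\<^sup>2"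
    using assms(4) by (intro mult_left_mono)
  also note assms(1)
  finally have "c * (d * (1249 / 1250 * c)) \<le> c * q ^ 3" by (simp add: mult_ac)
  then have 1: "d * (1249 / 1250 * c) \<le> q ^ 3" using c0 by simp
  \<comment> \<open>The constants fit because \<open>1249 / 1250 * 123 / 200 = 0.614508\<close>,
    just above \<open>1229 / 2000 = 0.6145\<close>.\<close>
  have "d * (1229 / 2000 * q ^ 2) \<le> d * (1249 / 1250 * c)"
  proof (rule mult_left_mono)
    show "1229 / 2000 * q ^ 2 \<le> 1249 / 1250 * c"
      using assms(2) zero_le_power2[of q] by linarith
  qed (rule assms(4))
  also note 1
  finally have "q\<^sup>2 * (d * 1229 / 2000) \<le> q\<^sup>2 * q"
    by (simp add: mult_ac power2_eq_square power3_eq_cube)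
  then show ?thesis using assms(3) by simp
qed

text \<open>For planes with no useful lower bound on \<open>c\<close>. If \<open>c > 2 * q\<close>,
  then \<open>c - q\<close> exceeds \<open>c / 2\<close>, so \<open>d * c\<close> is at most
  \<open>4 * q ^ 3\<close>, and \<open>d \<le> c\<close> finishes. Otherwise \<open>d\<close> is at
  most \<open>2 * q\<close>. This saves a factor of order \<open>q\<close> over the trivial
  \<open>d\<^sup>2 \<le> q ^ 4\<close>, enough to make the exceptional planes negligible.\<close>

lemma pencil_bound_sparse:
  fixes c d q :: real
  assumes "d * (c - q)\<^sup>2 \<le> c * q ^ 3" "d \<le> c" "q \<ge> 1" "d \<ge> 0"
  shows "d\<^sup>2 \<le> 4 * q ^ 3"
proof (cases "c \<le> 2 * q")
  case True
  have "d\<^sup>2 \<le> (2 * q)\<^sup>2" using True assms by (intro power_mono) auto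
  also have "\<dots> = 4 * q ^ 2" by (simp add: power2_eq_square)
  also have "\<dots> \<le> 4 * q ^ 3" using assms(3) by (simp add: power_increasing)
  finally show ?thesis .
next
  case False
  then have c0: "c > 0" using assms(3) by linarith
  have "(c / 2)\<^sup>2 \<le> (c - q)\<^sup>2" using False c0 by (intro power_mono) auto
  then have "d * (c / 2)\<^sup>2 \<le> d * (c - q)\<^sup>2" using assms(4) by (rule mult_left_mono)
  also note assms(1)
  finally have "c * (d * c) \<le> c * (4 * q ^ 3)" by (simp add: power2_eq_square field_simps)
  then have "d * c \<le> 4 * q ^ 3" using c0 by simp
  moreover have "d\<^sup>2 \<le> d * c" using assms by (simp add: power2_eq_square mult_left_mono)
  ultimately show ?thesis by linarith
qed


section \<open>Upper and lower bounds for the number of coplanar pairs of tangents\<close>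

context affine_3space
begin

text \<open>Outside the exceptional planes one factor of the square is replaced by its maximum
  \<open>2000 / 1229 * q\<close>; the other factors add up to at most
  \<open>card C * (q ^ 2 - 1)\<close>, since each tangent lies in \<open>q ^ 2 - 1\<close> listed
  planes. The exceptional planes add \<open>O(q ^ 5)\<close>, one order below the main term.\<close>

lemma sum_pencil_squares_le:
  assumes "C \<subseteq> V"
    and f: "\<And>x. x \<in> C \<Longrightarrow> f x \<in> Li" "\<And>x. x \<in> C \<Longrightarrow> T (f x) \<inter> C = {x}"
    and n: "real (card C) > 31 / 50 * real q ^ 3" and q: "q \<ge> 5000"
  shows "(\<Sum>i\<in>Pl. (real (card {x\<in>C. T (f x) \<subseteq> S i}))\<^sup>2)
    \<le> 2000 / 1229 * card C * real q ^ 3 + 160000 * real q ^ 5"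
proof -
  define c where "c i = real (card {x\<in>C. x \<in> S i})" for i
  define d where "d i = real (card {x\<in>C. T (f x) \<subseteq> S i})" for i
  \<comment> \<open>the planes where the complement has markedly less than its expected density; by the
    variance bound there are only \<open>O(q)\<close> of them, up to multiplicity\<close>
  define B where "B = {i\<in>Pl. c i < 123 / 200 * real q ^ 2}"
  have fC: "finite C" using assms finite_V finite_subset by blast
  have dc: "d i * (c i - real q)\<^sup>2 \<le> c i * real q ^ 3" if "i \<in> Pl" for i
    using pencil_bound[OF assms(1) that c_def f d_def] .
  have dle: "d i \<le> c i" for i
    unfolding d_def c_def using pencil_le[of C f i] assms by simp
  have d0: "0 \<le> d i" for i by (simp add: d_def)
  have "card C \<le> card V" using assms(1) finite_V by (rule card_mono[rotated])
  then have n_le: "real (card C) \<le> real q ^ 3" by (simp add: card_V flip: of_nat_power)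
  have card_B: "real (card B) \<le> 40000 * real q ^ 2"
  proof -
    \<comment> \<open>Chebyshev: the mean exceeds \<open>0.62 * q ^ 2\<close>, so a plane of
      \<open>B\<close> misses it by at least \<open>q ^ 2 / 200\<close>, while the total squared
      deviation is at most \<open>q ^ 6\<close>.\<close>
    have "real (card B) * (1 / 200 * real q ^ 2)\<^sup>2 = (\<Sum>i\<in>B. (1 / 200 * real q ^ 2)\<^sup>2)"
      by simp
    also have "\<dots> \<le> (\<Sum>i\<in>B. (card C / q - c i)\<^sup>2)"
    proof (intro sum_mono power_mono)
      fix i assume i: "i \<in> B"
      have "31 / 50 * real q ^ 2 \<le> card C / q"
        using n q by (simp add: field_simps power2_eq_square power3_eq_cube)
      moreover have "c i < 123 / 200 * real q ^ 2" using i by (simp add: B_def)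
      ultimately show "1 / 200 * real q ^ 2 \<le> card C / q - c i" by linarith
    qed auto
    also have "\<dots> = (\<Sum>i\<in>B. (c i - card C / q)\<^sup>2)"
      by (simp add: power2_commute)
    also have "\<dots> \<le> (\<Sum>i\<in>Pl. (c i - card C / q)\<^sup>2)"
      by (rule sum_mono2) (use finite_Pl in \<open>auto simp: B_def\<close>)
    also have "\<dots> \<le> real (card C) * real q ^ 3"
      unfolding c_def using plane_variance[OF assms(1)] .
    also have "\<dots> \<le> real q ^ 3 * real q ^ 3"
      using n_le by (rule mult_right_mono) simp
    finally have "real q ^ 4 * real (card B) \<le> real q ^ 4 * (40000 * real q ^ 2)"
      by (simp add: power_divide field_simps flip: power_mult power_add)
    then show ?thesis using q by simp
  qed
  have sum_d: "(\<Sum>i\<in>Pl. d i) = card C * (real q ^ 2 - 1)"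
    unfolding d_def using sum_card_filter[OF finite_Pl fC, of "\<lambda>i x. T (f x) \<subseteq> S i"] planes_line f(1)
    by simp
  have "(\<Sum>i\<in>Pl. (d i)\<^sup>2) \<le> (\<Sum>i\<in>Pl. 2000 / 1229 * real q * d i + (if i \<in> B then 4 * real q ^ 3 else 0))"
  proof (rule sum_mono)
    fix i assume i: "i \<in> Pl"
    show "(d i)\<^sup>2 \<le> 2000 / 1229 * real q * d i + (if i \<in> B then 4 * real q ^ 3 else 0)"
    proof (cases "i \<in> B")
      case True
      have "(d i)\<^sup>2 \<le> 4 * real q ^ 3"
        using pencil_bound_sparse[OF dc[OF i] dle _ d0] q by simp
      moreover have "0 \<le> 2000 / 1229 * real q * d i" using d0 by simp
      ultimately show ?thesis using True by simp
    next
      case False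
      have "d i \<le> 2000 / 1229 * real q"
        using pencil_bound_dense[OF dc[OF i] _ _ d0] False i q by (simp add: B_def)
      then have "d i * d i \<le> 2000 / 1229 * real q * d i"
        using d0 by (rule mult_right_mono)
      then show ?thesis using False by (simp add: power2_eq_square)
    qed
  qed
  also have "\<dots> = 2000 / 1229 * real q * (\<Sum>i\<in>Pl. d i) + (\<Sum>i\<in>Pl. if i \<in> B then 4 * real q ^ 3 else 0)"
    by (simp only: sum.distrib sum_distrib_left)
  also have "(\<Sum>i\<in>Pl. if i \<in> B then 4 * real q ^ 3 else 0) = real (card B) * (4 * real q ^ 3)"
    using finite_Pl by (simp add: sum.If_cases B_def Int_def)
  also have "2000 / 1229 * real q * (\<Sum>i\<in>Pl. d i) + real (card B) * (4 * real q ^ 3)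
      \<le> 2000 / 1229 * card C * real q ^ 3 + 160000 * real q ^ 5"
  proof -
    have "2000 / 1229 * real q * card C * (real q ^ 2 - 1) \<le> 2000 / 1229 * real q * card C * real q ^ 2"
      by (intro mult_left_mono) auto
    then have "2000 / 1229 * real q * (\<Sum>i\<in>Pl. d i) \<le> 2000 / 1229 * card C * real q ^ 3"
      unfolding sum_d by (simp add: power2_eq_square power3_eq_cube mult_ac)
    moreover have "real (card B) * (4 * real q ^ 3) \<le> 40000 * real q ^ 2 * (4 * real q ^ 3)"
      using card_B by (rule mult_right_mono) simp
    moreover have "real q ^ 2 * real q ^ 3 = real q ^ 5"
      by (simp flip: power_add)
    ultimately show ?thesis by linarith
  qed
  finally show ?thesis unfolding d_def .
qed

text \<open>The tangents have \<open>card C * (q - 1)\<close> incidences with the complement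
  \<open>N\<close> of \<open>C\<close>. Cauchy-Schwarz over the points of \<open>N\<close> bounds
  from below the number of triples of two tangents and a common point in \<open>N\<close>, and each
  such triple is paid for by \<open>q - 1\<close> listed planes containing both tangents.\<close>

lemma sum_pencil_squares_ge:
  assumes "C \<subseteq> V"
    and f: "\<And>x. x \<in> C \<Longrightarrow> f x \<in> Li" "\<And>x. x \<in> C \<Longrightarrow> T (f x) \<inter> C = {x}"
  shows "(real (card C))\<^sup>2 * (real q - 1) ^ 3
    \<le> (real q ^ 3 - card C) * (\<Sum>i\<in>Pl. (real (card {x\<in>C. T (f x) \<subseteq> S i}))\<^sup>2)"
proof -
  define N where "N = V - C"
  define m where "m y = real (card {x\<in>C. y \<in> T (f x)})" for y
  have fC: "finite C" using assms finite_V finite_subset by blast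
  have fN: "finite N" using finite_V by (simp add: N_def)
  have on_line: "real (card {y\<in>N. y \<in> T (f x)}) = real q - 1" if "x \<in> C" for x
  proof -
    have "{y\<in>N. y \<in> T (f x)} = T (f x) - {x}"
      using f(2)[OF that] line_subset[OF f(1)[OF that]] by (auto simp: N_def)
    moreover have "x \<in> T (f x)" using f(2)[OF that] by auto
    ultimately show ?thesis
      using card_line[OF f(1)[OF that]] q_ge_2 by (simp add: card_Diff_singleton of_nat_diff)
  qed
  have sum_m: "(\<Sum>y\<in>N. m y) = card C * (real q - 1)"
    unfolding m_def using on_line
    by (simp add: sum_card_filter[OF fN fC, of "\<lambda>y x. y \<in> T (f x)"])
  have "card V = card N + card C"
    using assms(1) fC finite_V by (simp add: N_def card_Diff_subset card_mono)
  then have card_N: "real (card N) = real q ^ 3 - card C"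
    unfolding card_V by (simp flip: of_nat_power)
  have "(real q - 1) * (\<Sum>y\<in>N. (m y)\<^sup>2) =
      (\<Sum>x\<in>C. \<Sum>z\<in>C. (real q - 1) * real (card {y\<in>N. y \<in> T (f x) \<and> y \<in> T (f z)}))"
    unfolding m_def sum_card_filter_squared[OF fN fC, of "\<lambda>y x. y \<in> T (f x)"] sum_distrib_left ..
  also have "\<dots> \<le> (\<Sum>x\<in>C. \<Sum>z\<in>C. real (card {i\<in>Pl. T (f x) \<subseteq> S i \<and> T (f z) \<subseteq> S i}))"
  proof (intro sum_mono)
    fix x z assume xz: "x \<in> C" "z \<in> C"
    let ?A = "{y\<in>N. y \<in> T (f x) \<and> y \<in> T (f z)}"
    show "(real q - 1) * real (card ?A) \<le> real (card {i\<in>Pl. T (f x) \<subseteq> S i \<and> T (f z) \<subseteq> S i})"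
    proof (cases "x = z")
      case True
      \<comment> \<open>The diagonal obeys the same bound: a tangent has \<open>q - 1\<close> points
        in \<open>N\<close>, and \<open>q ^ 2 - 1\<close> listed planes contain it.\<close>
      have "(real q - 1) * (real q - 1) \<le> real q ^ 2 - 1"
        using q_ge_2 by (simp add: power2_eq_square algebra_simps)
      then show ?thesis using True on_line[OF xz(1)] planes_line[OF f(1)[OF xz(1)]] by simp
    next
      case False
      show ?thesis
      proof (cases "?A = {}")
        case True
        then show ?thesis by (simp only: card.empty)
      next
        case nonempty: False
        then obtain y where y: "y \<in> T (f x)" "y \<in> T (f z)" by auto
        \<comment> \<open>Tangents at different points of contact are distinct lines, so they share
          at most one point.\<close>
        have "T (f x) \<noteq> T (f z)" using f(2) xz False by blast
        then have "?A \<subseteq> {y}"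
          using line_unique[OF f(1)[OF xz(1)] f(1)[OF xz(2)]] y by blast
        then have "card ?A \<le> 1" using card_mono[of "{y}" ?A] by simp
        then have "(real q - 1) * real (card ?A) \<le> (real q - 1) * 1"
          using q_ge_2 by (intro mult_left_mono) auto
        also have "\<dots> \<le> real (card {i\<in>Pl. T (f x) \<subseteq> S i \<and> T (f z) \<subseteq> S i})"
          using planes_meeting_lines[OF f(1)[OF xz(1)] f(1)[OF xz(2)] y] by simp
        finally show ?thesis .
      qed
    qed
  qed
  also have "\<dots> = (\<Sum>i\<in>Pl. (real (card {x\<in>C. T (f x) \<subseteq> S i}))\<^sup>2)"
    using sum_card_filter_squared[OF finite_Pl fC, of "\<lambda>i x. T (f x) \<subseteq> S i"] by simp
  finally have *: "(real q - 1) * (\<Sum>y\<in>N. (m y)\<^sup>2) \<le> \<dots>" .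
  have "(\<Sum>y\<in>N. m y)\<^sup>2 \<le> card N * (\<Sum>y\<in>N. (m y)\<^sup>2)"
    using sum_squared_le_sum_of_squares[of m N] by (simp add: mult.commute)
  then have "(card C * (real q - 1))\<^sup>2 * (real q - 1) \<le> card N * (\<Sum>y\<in>N. (m y)\<^sup>2) * (real q - 1)"
    unfolding sum_m using q_ge_2 by (intro mult_right_mono) auto
  also have "\<dots> \<le> card N * (\<Sum>i\<in>Pl. (real (card {x\<in>C. T (f x) \<subseteq> S i}))\<^sup>2)"
    using mult_left_mono[OF *, of "real (card N)"] by (simp add: mult_ac)
  finally show ?thesis
    by (simp add: card_N power2_eq_square power3_eq_cube mult_ac)
qed

text \<open>If \<open>C\<close> were larger, the two bounds for the sum of squares would contradict
  each other once \<open>q\<close> is large enough for the lower order terms to be absorbed.\<close>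

lemma card_tangent_set_le:
  assumes "C \<subseteq> V"
    and f: "\<And>x. x \<in> C \<Longrightarrow> f x \<in> Li" "\<And>x. x \<in> C \<Longrightarrow> T (f x) \<inter> C = {x}"
    and q: "q \<ge> 10 ^ 8"
  shows "real (card C) \<le> 31 / 50 * real q ^ 3"
proof (rule ccontr)
  assume "\<not> ?thesis"
  then have n: "real (card C) > 31 / 50 * real q ^ 3" by simp
  define Q where "Q = real q"
  define n' where "n' = real (card C)"
  have Q: "Q \<ge> 100000000" using q by (simp add: Q_def)
  have n: "n' > 31 / 50 * Q ^ 3" using n by (simp add: Q_def n'_def)
  have "card C \<le> card V" using assms(1) finite_V by (rule card_mono[rotated])
  then have n_le: "n' \<le> Q ^ 3" by (simp add: card_V n'_def Q_def flip: of_nat_power)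
  have Q3: "Q ^ 3 > 0" using Q by simp
  then have n0: "n' > 0" using n by linarith
  \<comment> \<open>One factor \<open>n'\<close> is kept on each side for cancelling; the other
    occurrences are replaced by the assumed bound, which also gives
    \<open>Q ^ 3 - n' < 19 / 50 * Q ^ 3\<close>.\<close>
  have "n' * (31 / 50 * Q ^ 3) * (Q - 1) ^ 3 \<le> n' * n' * (Q - 1) ^ 3"
    using n n0 Q by (intro mult_left_mono mult_right_mono) auto
  also have "\<dots> \<le> (Q ^ 3 - n') * (\<Sum>i\<in>Pl. (real (card {x\<in>C. T (f x) \<subseteq> S i}))\<^sup>2)"
    using sum_pencil_squares_ge[OF assms(1) f] by (simp add: Q_def n'_def power2_eq_square)
  also have "\<dots> \<le> (Q ^ 3 - n') * (2000 / 1229 * n' * Q ^ 3 + 160000 * Q ^ 5)"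
    using sum_pencil_squares_le[OF assms(1) f] n q n_le
    by (intro mult_left_mono) (auto simp: Q_def n'_def)
  also have "\<dots> \<le> 19 / 50 * Q ^ 3 * (2000 / 1229 * n' * Q ^ 3 + 160000 * Q ^ 5)"
    using n n0 Q by (intro mult_right_mono) auto
  also have "\<dots> \<le> 19 / 50 * Q ^ 3 * (2000 / 1229 * n' * Q ^ 3 + 260000 * n' * Q ^ 2)"
  proof (intro mult_left_mono add_left_mono)
    have "160000 * Q ^ 5 = 160000 * Q ^ 3 * Q ^ 2" by (simp flip: power_add)
    also have "\<dots> \<le> 260000 * n' * Q ^ 2"
    proof (rule mult_right_mono)
      \<comment> \<open>\<open>0.62 * 260000 = 161200\<close>, so the error term too becomes a
        multiple of \<open>n'\<close>.\<close>
      show "160000 * Q ^ 3 \<le> 260000 * n'" using n Q3 by linarith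
    qed simp
    finally show "160000 * Q ^ 5 \<le> 260000 * n' * Q ^ 2" .
  qed (use Q in auto)
  finally have "(n' * Q ^ 3) * (31 / 50 * (Q - 1) ^ 3)
      \<le> (n' * Q ^ 3) * (19 / 50 * (2000 / 1229 * Q ^ 3 + 260000 * Q ^ 2))"
    by (simp add: algebra_simps)
  \<comment> \<open>The leading coefficients are now \<open>0.62\<close> on the left and
    \<open>0.38 * 2000 / 1229 = 0.6183...\<close> on the right, which is impossible for large
    \<open>Q\<close>.\<close>
  then have 1: "31 / 50 * (Q - 1) ^ 3 \<le> 19 / 50 * (2000 / 1229 * Q ^ 3 + 260000 * Q ^ 2)"
    using n0 Q3 by (subst (asm) mult_le_cancel_left_pos) auto
  have "(Q - 1) ^ 3 = Q ^ 3 - 3 * Q ^ 2 + 3 * Q - 1"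
    by (simp add: power2_eq_square power3_eq_cube algebra_simps)
  then have "31 / 50 * (Q ^ 3 - 3 * Q ^ 2) \<le> 31 / 50 * (Q - 1) ^ 3"
    using Q by (intro mult_left_mono) auto
  also note 1
  finally have 2: "31 / 50 * (Q ^ 3 - 3 * Q ^ 2) \<le> 19 / 50 * (2000 / 1229 * Q ^ 3 + 260000 * Q ^ 2)" .
  have "100000000 * Q ^ 2 \<le> Q ^ 3"
    unfolding power3_eq_cube power2_eq_square using Q by (simp add: mult_right_mono)
  moreover have "Q ^ 2 > 0" using Q by simp
  \<comment> \<open>Multiplication by \<open>50 * 1229\<close> clears denominators, with
    \<open>99 = 31 * 1229 - 19 * 2000\<close>. The inequality forces \<open>Q\<close> below about
    \<open>6.2 * 10 ^ 7\<close>, against the assumed \<open>10 ^ 8\<close>.\<close>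
  moreover have "99 * Q ^ 3 \<le> 6071374297 * Q ^ 2" using 2 by (simp add: field_simps)
  ultimately show False by linarith
qed

end

section \<open>Points and lines over a finite field\<close>

locale finite_field_space = field F for F (structure) +
  fixes n :: nat
  assumes finite_F: "finite (carrier F)"
begin

definition V where "V = aff_space F n"
text \<open>The point with parameter \<open>t\<close> on the line from \<open>p\<close> in direction
  \<open>v\<close>. Parameters \<open>\<one>\<close> and \<open>\<ominus> \<one>\<close> make it
  serve as vector addition and subtraction as well.\<close>

definition pt where "pt p v t = vector_add F n p (vector_scale F n t v)"
definition line where "line p v = pt p v ` carrier F"
definition dot where "dot a x = (\<Oplus>i\<in>{..<n}. a i \<otimes> x i)"

abbreviation origin where "origin \<equiv> zero_vector F n"
abbreviation scale where "scale \<equiv> vector_scale F n"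

lemma add_diff_cancel: "\<lbrakk>a \<in> carrier F; b \<in> carrier F\<rbrakk> \<Longrightarrow> a \<oplus> (b \<ominus> a) = b"
  by (simp add: a_minus_def a_lcomm[of a b] r_neg)

lemma add_left_cancel: "\<lbrakk>a \<in> carrier F; b \<in> carrier F; c \<in> carrier F; a \<oplus> b = a \<oplus> c\<rbrakk> \<Longrightarrow> b = c"
  by (metis r_neg1)

lemma V_memI: "\<lbrakk>\<And>i. i < n \<Longrightarrow> x i \<in> carrier F; \<And>i. \<not> i < n \<Longrightarrow> x i = undefined\<rbrakk> \<Longrightarrow> x \<in> V"
  by (auto simp: V_def aff_space_def)

lemma V_coord [simp, intro]: "x \<in> V \<Longrightarrow> i < n \<Longrightarrow> x i \<in> carrier F"
  by (auto simp: V_def aff_space_def)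

lemma V_eqI: "\<lbrakk>x \<in> V; y \<in> V; \<And>i. i < n \<Longrightarrow> x i = y i\<rbrakk> \<Longrightarrow> x = y"
  unfolding V_def aff_space_def by (rule PiE_ext) auto

lemma origin_closed [simp, intro]: "origin \<in> V"
  by (rule V_memI) (auto simp: zero_vector_def)

lemma scale_closed [simp, intro]: "\<lbrakk>t \<in> carrier F; v \<in> V\<rbrakk> \<Longrightarrow> scale t v \<in> V"
  by (rule V_memI) (auto simp: vector_scale_def)

lemma pt_closed [simp, intro]: "\<lbrakk>p \<in> V; v \<in> V; t \<in> carrier F\<rbrakk> \<Longrightarrow> pt p v t \<in> V"
  by (rule V_memI) (auto simp: pt_def vector_add_def vector_scale_def)

lemma origin_coord: "i < n \<Longrightarrow> origin i = \<zero>"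
  by (simp add: zero_vector_def)

lemma scale_coord: "i < n \<Longrightarrow> scale t v i = t \<otimes> v i"
  by (simp add: vector_scale_def)

lemma pt_coord: "i < n \<Longrightarrow> pt p v t i = p i \<oplus> t \<otimes> v i"
  by (simp add: pt_def vector_add_def vector_scale_def)

lemmas coord_simps = origin_coord scale_coord pt_coord

lemma finite_V [simp]: "finite V"
  by (simp add: V_def aff_space_def finite_PiE finite_F)

lemma card_V: "card V = order F ^ n"
  by (simp add: V_def aff_space_def card_PiE order_def)

lemma pt_zero [simp]: "\<lbrakk>p \<in> V; v \<in> V\<rbrakk> \<Longrightarrow> pt p v \<zero> = p"
  by (rule V_eqI) (auto simp: coord_simps)

lemma pt_origin [simp]: "\<lbrakk>p \<in> V; t \<in> carrier F\<rbrakk> \<Longrightarrow> pt p origin t = p"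
  by (rule V_eqI) (auto simp: coord_simps)

lemma pt_pt: "\<lbrakk>p \<in> V; v \<in> V; s \<in> carrier F; t \<in> carrier F\<rbrakk> \<Longrightarrow> pt (pt p v s) v t = pt p v (s \<oplus> t)"
  by (rule V_eqI) (auto simp: coord_simps l_distr a_assoc)

lemma pt_scale: "\<lbrakk>p \<in> V; v \<in> V; s \<in> carrier F; t \<in> carrier F\<rbrakk> \<Longrightarrow> pt p (scale s v) t = pt p v (t \<otimes> s)"
  by (rule V_eqI) (auto simp: coord_simps m_assoc)

lemma scale_scale: "\<lbrakk>v \<in> V; s \<in> carrier F; t \<in> carrier F\<rbrakk> \<Longrightarrow> scale s (scale t v) = scale (s \<otimes> t) v"
  by (rule V_eqI) (auto simp: coord_simps m_assoc)

lemma scale_one [simp]: "v \<in> V \<Longrightarrow> scale \<one> v = v"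
  by (rule V_eqI) (auto simp: coord_simps)

lemma nonzero_coord:
  assumes "v \<in> V" "v \<noteq> origin"
  obtains i where "i < n" "v i \<in> carrier F - {\<zero>}"
  using assms V_eqI[OF assms(1) origin_closed] by (metis DiffI V_coord singletonD origin_coord)

lemma scale_inject:
  assumes "v \<in> V" "v \<noteq> origin" "s \<in> carrier F" "t \<in> carrier F" "scale s v = scale t v"
  shows "s = t"
proof -
  obtain i where i: "i < n" "v i \<in> carrier F - {\<zero>}" using nonzero_coord[OF assms(1,2)] .
  have "s \<otimes> v i = t \<otimes> v i" using assms(5) i(1) by (metis scale_coord)
  then show ?thesis using i assms m_rcancel by auto
qed

lemma scale_eq_origin_iff: "\<lbrakk>v \<in> V; v \<noteq> origin; s \<in> carrier F\<rbrakk> \<Longrightarrow> scale s v = origin \<longleftrightarrow> s = \<zero>"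
  using scale_inject[of v s \<zero>] V_eqI[of "scale \<zero> v" origin] by (auto simp: coord_simps)

lemma pt_inject_point: "\<lbrakk>p \<in> V; p' \<in> V; v \<in> V; t \<in> carrier F; pt p v t = pt p' v t\<rbrakk> \<Longrightarrow> p = p'"
  by (rule V_eqI) (auto, metis V_coord add_left_cancel a_comm m_closed pt_coord)

lemma pt_inject_direction: "\<lbrakk>p \<in> V; v \<in> V; v' \<in> V; pt p v \<one> = pt p v' \<one>\<rbrakk> \<Longrightarrow> v = v'"
  by (rule V_eqI) (auto, metis V_coord add_left_cancel l_one pt_coord)

lemma pt_inject_param:
  assumes "p \<in> V" "v \<in> V" "v \<noteq> origin" "s \<in> carrier F" "t \<in> carrier F" "pt p v s = pt p v t"
  shows "s = t"
proof (rule scale_inject[OF assms(2-5)])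
  show "scale s v = scale t v"
    using assms by (intro V_eqI) (auto, metis V_coord add_left_cancel m_closed pt_coord scale_coord)
qed

lemma ex_direction:
  assumes "x \<in> V" "y \<in> V"
  obtains u where "u \<in> V" "y = pt x u \<one>"
proof
  show "(\<lambda>i\<in>{..<n}. y i \<ominus> x i) \<in> V"
    using assms by (intro V_memI) auto
  then show "y = pt x (\<lambda>i\<in>{..<n}. y i \<ominus> x i) \<one>"
    using assms by (intro V_eqI) (auto simp: coord_simps add_diff_cancel)
qed

lemma pt_pt_neg: "\<lbrakk>p \<in> V; v \<in> V; s \<in> carrier F\<rbrakk> \<Longrightarrow> pt (pt p v s) v (\<ominus> s) = p"
  by (simp add: pt_pt r_neg)

lemma line_subset: "\<lbrakk>p \<in> V; v \<in> V\<rbrakk> \<Longrightarrow> line p v \<subseteq> V"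
  by (auto simp: line_def)

lemma card_line: "\<lbrakk>p \<in> V; v \<in> V; v \<noteq> origin\<rbrakk> \<Longrightarrow> card (line p v) = order F"
  unfolding line_def order_def by (intro card_image inj_onI pt_inject_param)

text \<open>For nonzero \<open>t\<close> the map sending \<open>r\<close> to
  \<open>s \<oplus> r \<otimes> t\<close> permutes the field.\<close>

lemma line_reparam:
  assumes "p \<in> V" "v \<in> V" "s \<in> carrier F" "t \<in> carrier F - {\<zero>}"
  shows "line (pt p v s) (scale t v) = line p v"
proof -
  have "pt (pt p v s) (scale t v) r = pt p v (s \<oplus> r \<otimes> t)" if "r \<in> carrier F" for r
    using assms that by (simp add: pt_scale pt_pt)
  then have "line (pt p v s) (scale t v) = pt p v ` (\<lambda>r. s \<oplus> r \<otimes> t) ` carrier F"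
    unfolding line_def image_image by (intro image_cong) auto
  also have "(\<lambda>r. s \<oplus> r \<otimes> t) ` carrier F = carrier F"
  proof (intro equalityI subsetI)
    fix r' assume r': "r' \<in> carrier F"
    have t: "t \<in> Units F" using assms field_Units by simp
    have "r' = s \<oplus> ((r' \<ominus> s) \<otimes> inv t) \<otimes> t"
      using assms r' t by (simp add: m_assoc add_diff_cancel)
    moreover have "(r' \<ominus> s) \<otimes> inv t \<in> carrier F"
      using assms r' t by simp
    ultimately show "r' \<in> (\<lambda>r. s \<oplus> r \<otimes> t) ` carrier F" by (rule image_eqI)
  qed (use assms in auto)
  finally show ?thesis unfolding line_def .
qed

text \<open>Converse to \<open>line_reparam\<close>: if \<open>d\<close> is the difference of the
  parameters of \<open>y\<close> and \<open>x\<close>, then \<open>u\<close> is \<open>d\<close>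
  times \<open>v\<close> and \<open>d\<close> is nonzero, so \<open>p\<close> and \<open>v\<close>
  can be expressed through \<open>x\<close> and \<open>u\<close>.\<close>

lemma line_two_points:
  assumes "p \<in> V" "v \<in> V" "x \<in> line p v" "y \<in> line p v" "x \<noteq> y"
    and u: "u \<in> V" "y = pt x u \<one>"
  obtains s t where "s \<in> carrier F" "t \<in> carrier F - {\<zero>}" "p = pt x u s" "v = scale t u"
proof -
  obtain s t where s: "s \<in> carrier F" "x = pt p v s" and t: "t \<in> carrier F" "y = pt p v t"
    using assms unfolding line_def by auto
  define d where "d = t \<ominus> s"
  have d: "d \<in> carrier F" using s t by (simp add: d_def)
  have xV: "x \<in> V" using assms(1,2) s by auto
  have y: "pt x v d = y"
    unfolding s(2) t(2) d_def using assms(1,2) s(1) t(1) by (simp add: pt_pt add_diff_cancel)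
  have du: "u = scale d v"
  proof (rule pt_inject_direction[OF xV u(1)])
    show "scale d v \<in> V" using assms(2) d by simp
    show "pt x u \<one> = pt x (scale d v) \<one>"
      using y u(2) xV assms(2) d by (simp add: pt_scale)
  qed
  have d0: "d \<noteq> \<zero>"
    using y assms(2,5) xV by auto
  then have U: "d \<in> Units F" using d field_Units by simp
  have v: "v = scale (inv d) u"
    unfolding du using assms(2) d U by (simp add: scale_scale)
  have "p = pt x v (\<ominus> s)"
    using s assms(1,2) by (simp add: pt_pt_neg)
  also have "\<dots> = pt x u (\<ominus> s \<otimes> inv d)"
    unfolding v using xV u(1) s(1) U by (intro pt_scale) auto
  finally have p: "p = pt x u (\<ominus> s \<otimes> inv d)" .
  have "inv d \<in> carrier F - {\<zero>}"
    using U field_Units Units_inv_Units by blast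
  then show ?thesis
    using that[OF _ _ p v] s(1) by simp
qed

lemma line_eq_through:
  assumes "p \<in> V" "v \<in> V" "x \<in> line p v" "y \<in> line p v" "x \<noteq> y"
    and u: "u \<in> V" "y = pt x u \<one>"
  shows "line p v = line x u"
proof -
  have "x \<in> V" using assms line_subset by blast
  then show ?thesis
    using line_two_points[OF assms] line_reparam[OF _ u(1)] by metis
qed

lemma line_eqI:
  assumes "p \<in> V" "v \<in> V" "p' \<in> V" "v' \<in> V"
    "x \<in> line p v" "y \<in> line p v" "x \<in> line p' v'" "y \<in> line p' v'" "x \<noteq> y"
  shows "line p v = line p' v'"
proof -
  have "x \<in> V" "y \<in> V" using assms line_subset by blast+
  then obtain u where "u \<in> V" "y = pt x u \<one>" by (rule ex_direction)
  then show ?thesis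
    using line_eq_through[OF assms(1,2,5,6,9)] line_eq_through[OF assms(3,4,7-9)] by metis
qed

lemma base_on_line: "\<lbrakk>p \<in> V; v \<in> V\<rbrakk> \<Longrightarrow> p \<in> line p v"
  unfolding line_def by (rule image_eqI[of _ _ \<zero>]) auto

text \<open>With \<open>u\<close> the difference of the points, the listings of their line are
  exactly the pairs of a base point \<open>pt x u s\<close> and a direction \<open>scale t u\<close>
  with \<open>t\<close> nonzero.\<close>

lemma card_lines_2points:
  assumes "x \<in> V" "y \<in> V" "x \<noteq> y"
  shows "card {(p, v) \<in> V \<times> (V - {origin}). x \<in> line p v \<and> y \<in> line p v} = order F * (order F - 1)"
proof -
  obtain u where u: "u \<in> V" "y = pt x u \<one>" using ex_direction[OF assms(1,2)] .
  have uz: "u \<noteq> origin" using u(2) assms(1,3) by auto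
  have "{(p, v) \<in> V \<times> (V - {origin}). x \<in> line p v \<and> y \<in> line p v}
      = (\<lambda>(s, t). (pt x u s, scale t u)) ` (carrier F \<times> (carrier F - {\<zero>}))" (is "?L = ?f ` ?A")
  proof (intro equalityI subsetI)
    fix l assume "l \<in> ?L"
    then obtain p v where l: "l = (p, v)" "p \<in> V" "v \<in> V" "x \<in> line p v" "y \<in> line p v" by auto
    obtain s t where "s \<in> carrier F" "t \<in> carrier F - {\<zero>}" "p = pt x u s" "v = scale t u"
      using line_two_points[OF l(2-5) assms(3) u] .
    then show "l \<in> ?f ` ?A"
      unfolding l(1) by (intro image_eqI[of _ _ "(s, t)"]) auto
  next
    fix l assume "l \<in> ?f ` ?A"
    then obtain s t where st: "s \<in> carrier F" "t \<in> carrier F - {\<zero>}" "l = (pt x u s, scale t u)" by auto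
    have "x \<in> line x u" "y \<in> line x u"
      using base_on_line[OF assms(1) u(1)] unfolding u(2) line_def by auto
    then show "l \<in> ?L"
      using st line_reparam[OF assms(1) u(1) st(1,2)] assms(1) u(1) uz by (simp add: scale_eq_origin_iff)
  qed
  moreover have "inj_on ?f ?A"
    using pt_inject_param[OF assms(1) u(1) uz] scale_inject[OF u(1) uz]
    by (auto intro!: inj_onI)
  ultimately show ?thesis
    using finite_F by (simp add: card_image card_cartesian_product order_def card_Diff_singleton)
qed

section \<open>Linear forms and hyperplanes\<close>

lemma dot_closed [simp, intro]: "\<lbrakk>a \<in> V; x \<in> V\<rbrakk> \<Longrightarrow> dot a x \<in> carrier F"
  unfolding dot_def by (intro finsum_closed) auto

lemma dot_commute: "\<lbrakk>a \<in> V; x \<in> V\<rbrakk> \<Longrightarrow> dot a x = dot x a"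
  unfolding dot_def by (intro finsum_cong') (auto simp: m_comm)

lemma dot_origin [simp]: "a \<in> V \<Longrightarrow> dot a origin = \<zero>"
proof -
  assume a: "a \<in> V"
  have "dot a origin = (\<Oplus>i\<in>{..<n}. \<zero>)"
    unfolding dot_def using a by (intro finsum_cong') (auto simp: coord_simps)
  then show ?thesis by simp
qed

lemma dot_pt:
  assumes "a \<in> V" "p \<in> V" "v \<in> V" "t \<in> carrier F"
  shows "dot a (pt p v t) = dot a p \<oplus> t \<otimes> dot a v"
proof -
  have "dot a (pt p v t) = (\<Oplus>i\<in>{..<n}. a i \<otimes> p i \<oplus> t \<otimes> (a i \<otimes> v i))"
    unfolding dot_def using assms by (intro finsum_cong') (auto simp: coord_simps r_distr m_lcomm)
  also have "\<dots> = (\<Oplus>i\<in>{..<n}. a i \<otimes> p i) \<oplus> (\<Oplus>i\<in>{..<n}. t \<otimes> (a i \<otimes> v i))"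
    using assms by (intro finsum_addf) auto
  also have "(\<Oplus>i\<in>{..<n}. t \<otimes> (a i \<otimes> v i)) = t \<otimes> (\<Oplus>i\<in>{..<n}. a i \<otimes> v i)"
    using assms by (intro finsum_rdistr[symmetric]) auto
  finally show ?thesis unfolding dot_def .
qed

text \<open>The witness is a coordinate vector at a nonzero entry of \<open>a\<close>, divided by
  that entry.\<close>

lemma dot_nondegenerate:
  assumes "a \<in> V" "a \<noteq> origin"
  obtains e where "e \<in> V" "dot a e = \<one>"
proof -
  obtain j where j: "j < n" "a j \<in> carrier F - {\<zero>}" using nonzero_coord[OF assms] .
  then have aj: "a j \<in> Units F" using field_Units by simp
  define e where "e = (\<lambda>i\<in>{..<n}. if i = j then inv (a j) else \<zero>)"
  have "e \<in> V" using aj by (intro V_memI) (auto simp: e_def)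
  have "dot a e = (\<Oplus>i\<in>{..<n}. if j = i then a j \<otimes> inv (a j) else \<zero>)"
    unfolding dot_def e_def using assms aj j by (intro finsum_cong') auto
  also have "\<dots> = a j \<otimes> inv (a j)"
    using j aj finsum_singleton[of j "{..<n}" "\<lambda>_. a j \<otimes> inv (a j)"] by auto
  finally have "dot a e = \<one>" using aj by simp
  with \<open>e \<in> V\<close> show ?thesis by (rule that)
qed

text \<open>Translation along a vector \<open>e\<close> with \<open>dot a e = \<one>\<close> maps
  any level set injectively into any other, so the level sets have equal size, and they partition
  the space.\<close>

lemma card_hyperplane:
  assumes "a \<in> V" "a \<noteq> origin" "b \<in> carrier F"
  shows "order F * card {x\<in>V. dot a x = b} = order F ^ n"
proof -
  obtain e where e: "e \<in> V" "dot a e = \<one>" using dot_nondegenerate[OF assms(1,2)] .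
  let ?P = "\<lambda>b. {x\<in>V. dot a x = b}"
  have le: "card (?P b) \<le> card (?P c)" if "b \<in> carrier F" "c \<in> carrier F" for b c
  proof (rule card_inj_on_le)
    show "inj_on (\<lambda>x. pt x e (c \<ominus> b)) (?P b)"
      using e that pt_inject_point[of _ _ e "c \<ominus> b"] by (auto intro!: inj_onI)
    show "(\<lambda>x. pt x e (c \<ominus> b)) ` ?P b \<subseteq> ?P c"
      using e that assms(1) by (auto simp: dot_pt add_diff_cancel)
  qed simp
  have "V = (\<Union>c\<in>carrier F. ?P c)" using assms(1) by auto
  then have "card V = (\<Sum>c\<in>carrier F. card (?P c))"
    using finite_F by (subst (1) \<open>V = _\<close>, subst card_UN_disjoint) auto
  also have "\<dots> = (\<Sum>c\<in>carrier F. card (?P b))"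
    using le assms(3) by (intro sum.cong refl antisym) auto
  finally show ?thesis
    by (simp add: card_V order_def)
qed

text \<open>\<open>K\<close> is closed under linear combinations \<open>x + t y\<close>. Subtracting
  a fixed element embeds each nonempty level set of the form into its kernel. Some level sets may be
  empty, hence only an inequality.\<close>

lemma card_kernel_ge:
  assumes K: "K \<subseteq> V" "\<And>x y t. \<lbrakk>x \<in> K; y \<in> K; t \<in> carrier F\<rbrakk> \<Longrightarrow> pt x y t \<in> K" and w: "w \<in> V"
  shows "card K \<le> order F * card {x\<in>K. dot w x = \<zero>}"
proof -
  have fK: "finite K" using K(1) finite_V finite_subset by blast
  have le: "card {x\<in>K. dot w x = b} \<le> card {x\<in>K. dot w x = \<zero>}" for b
  proof (cases "{x\<in>K. dot w x = b} = {}")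
    case False
    then obtain y where y: "y \<in> K" "dot w y = b" by auto
    then have yV: "y \<in> V" using K(1) by auto
    have m: "\<ominus> \<one> \<in> carrier F" by simp
    show ?thesis
    proof (rule card_inj_on_le)
      show "inj_on (\<lambda>x. pt x y (\<ominus> \<one>)) {x\<in>K. dot w x = b}"
        using pt_inject_point[OF _ _ yV m] K(1) by (auto intro!: inj_onI)
      have "pt x y (\<ominus> \<one>) \<in> K \<and> dot w (pt x y (\<ominus> \<one>)) = \<zero>" if x: "x \<in> K" "dot w x = b" for x
      proof -
        have "x \<in> V" using x K(1) by auto
        then have "dot w (pt x y (\<ominus> \<one>)) = b \<oplus> \<ominus> \<one> \<otimes> b"
          using dot_pt[OF w _ yV m] x y by simp
        also have "\<dots> = \<zero>"
          using dot_closed[OF w yV] y by (simp add: l_minus r_neg)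
        finally show ?thesis using K(2)[OF x(1) y(1) m] by simp
      qed
      then show "(\<lambda>x. pt x y (\<ominus> \<one>)) ` {x\<in>K. dot w x = b} \<subseteq> {x\<in>K. dot w x = \<zero>}"
        by auto
    qed (use fK in simp)
  qed (simp only: card.empty)
  have "card K = card (\<Union>b\<in>carrier F. {x\<in>K. dot w x = b})"
    using K(1) w by (intro arg_cong[of _ _ card]) auto
  also have "\<dots> \<le> (\<Sum>b\<in>carrier F. card {x\<in>K. dot w x = b})"
    using finite_F by (rule card_UN_le)
  also have "\<dots> \<le> (\<Sum>b\<in>carrier F. card {x\<in>K. dot w x = \<zero>})"
    using le by (rule sum_mono)
  finally show ?thesis by (simp add: order_def)
qed

text \<open>Two linear conditions, possibly dependent, each shrink the space by a factor of at most
  \<open>q\<close>.\<close>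

lemma card_double_kernel_ge:
  assumes "u \<in> V" "w \<in> V"
  shows "order F ^ n \<le> order F ^ 2 * card {a\<in>V. dot u a = \<zero> \<and> dot w a = \<zero>}"
proof -
  define K where "K = {a\<in>V. dot u a = \<zero>}"
  have "order F ^ n \<le> order F * card K"
    unfolding K_def card_V[symmetric] using assms(1) by (intro card_kernel_ge) auto
  also have "card K \<le> order F * card {a\<in>K. dot w a = \<zero>}"
    using assms by (intro card_kernel_ge) (auto simp: K_def dot_pt)
  finally show ?thesis
    by (simp add: K_def power2_eq_square mult_ac conj_assoc)
qed

text \<open>Along the line the form is affine in the parameter with slope \<open>dot a v\<close>;
  the parameters \<open>\<zero>\<close> and \<open>\<one>\<close> already detect a nonzero
  slope.\<close>

lemma line_subset_hyperplane_iff: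
  assumes "a \<in> V" "b \<in> carrier F" "p \<in> V" "v \<in> V"
  shows "line p v \<subseteq> {x\<in>V. dot a x = b} \<longleftrightarrow> dot a p = b \<and> dot a v = \<zero>"
proof
  assume L: "line p v \<subseteq> {x\<in>V. dot a x = b}"
  have p: "dot a p = b" using base_on_line[OF assms(3,4)] L by auto
  have "pt p v \<one> \<in> line p v" by (auto simp: line_def)
  then have "dot a (pt p v \<one>) = b" using L by blast
  then have "b \<oplus> dot a v = b \<oplus> \<zero>" using p assms dot_pt[of a p v \<one>] by simp
  then have "dot a v = \<zero>" using assms add_left_cancel[of b "dot a v" \<zero>] by blast
  with p show "dot a p = b \<and> dot a v = \<zero>" ..
next
  assume "dot a p = b \<and> dot a v = \<zero>"
  then show "line p v \<subseteq> {x\<in>V. dot a x = b}"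
    using assms by (auto simp: line_def dot_pt)
qed

lemma line_in_hyperplane:
  assumes "a \<in> V" "b \<in> carrier F" "p \<in> V" "v \<in> V" "x \<in> line p v" "y \<in> line p v" "x \<noteq> y"
    and xy: "dot a x = b" "dot a y = b"
  shows "line p v \<subseteq> {x\<in>V. dot a x = b}"
proof -
  have V: "x \<in> V" "y \<in> V" using assms line_subset by blast+
  then obtain u where u: "u \<in> V" "y = pt x u \<one>" by (rule ex_direction)
  have "b \<oplus> dot a u = b \<oplus> \<zero>" using xy u V assms(1,2) dot_pt[of a x u \<one>] by simp
  then have "dot a u = \<zero>" using assms(1,2) u(1) add_left_cancel[of b "dot a u" \<zero>] by blast
  then have "line x u \<subseteq> {x\<in>V. dot a x = b}"
    using line_subset_hyperplane_iff[OF assms(1,2) V(1) u(1)] xy(1) by simp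
  then show ?thesis
    using line_eq_through[OF assms(3-7) u] by simp
qed

section \<open>Incidence counts for listed hyperplanes and lines\<close>

abbreviation hyperplanes where "hyperplanes \<equiv> (V - {origin}) \<times> carrier F"
definition hyperplane where "hyperplane i = {x\<in>V. dot (fst i) x = snd i}"
abbreviation lines where "lines \<equiv> V \<times> (V - {origin})"
definition line_of where "line_of j = line (fst j) (snd j)"

lemma card_nonzero_orthogonal:
  assumes "P origin"
  shows "card {v\<in>V - {origin}. P v} = card {v\<in>V. P v} - 1"
proof -
  have "{v\<in>V - {origin}. P v} = {v\<in>V. P v} - {origin}" by auto
  then show ?thesis using assms by (simp add: card_Diff_singleton)
qed

text \<open>Passing through \<open>x\<close> fixes the constant term, so only the nonzero normal
  vector remains free; \<open>P\<close> carries further conditions on it.\<close>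

lemma card_hyperplanes_through:
  assumes "x \<in> V"
  shows "card {i\<in>hyperplanes. x \<in> hyperplane i \<and> P (fst i)} = card {a\<in>V - {origin}. P a}"
proof -
  have "{i\<in>hyperplanes. x \<in> hyperplane i \<and> P (fst i)} = (\<lambda>a. (a, dot a x)) ` {a\<in>V - {origin}. P a}"
    using assms by (auto simp: hyperplane_def)
  then show ?thesis by (simp add: card_image inj_on_def)
qed

text \<open>Turns incidence with a second point into a linear equation for the normal vector, with
  coefficient vector \<open>u\<close>.\<close>

lemma hyperplane_direction_iff:
  assumes "i \<in> hyperplanes" "x \<in> hyperplane i" "u \<in> V"
  shows "pt x u \<one> \<in> hyperplane i \<longleftrightarrow> dot u (fst i) = \<zero>"
proof -
  obtain a b where i: "i = (a, b)" "a \<in> V" "b \<in> carrier F" using assms(1) by auto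
  have x: "x \<in> V" "dot a x = b" using assms(2) i by (auto simp: hyperplane_def)
  have "dot a (pt x u \<one>) = b \<longleftrightarrow> b \<oplus> dot a u = b \<oplus> \<zero>"
    using x i assms(3) by (simp add: dot_pt)
  also have "\<dots> \<longleftrightarrow> dot a u = \<zero>"
    using x i assms(3) add_left_cancel[of b "dot a u" \<zero>] by auto
  finally show ?thesis
    using x i assms(3) by (simp add: hyperplane_def dot_commute)
qed

text \<open>The normals are the nonzero vectors orthogonal to the difference of the points; the
  added \<open>1\<close> accounts for the zero vector.\<close>

lemma card_hyperplanes_2points:
  assumes "x \<in> V" "y \<in> V" "x \<noteq> y"
  shows "order F * (card {i\<in>hyperplanes. x \<in> hyperplane i \<and> y \<in> hyperplane i} + 1) = order F ^ n"
proof -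
  obtain u where u: "u \<in> V" "y = pt x u \<one>" using ex_direction[OF assms(1,2)] .
  have uz: "u \<noteq> origin" using u(2) assms(1,3) by auto
  have "{i\<in>hyperplanes. x \<in> hyperplane i \<and> y \<in> hyperplane i}
      = {i\<in>hyperplanes. x \<in> hyperplane i \<and> dot u (fst i) = \<zero>}"
    unfolding u(2) using hyperplane_direction_iff[OF _ _ u(1)] by blast
  then have "card {i\<in>hyperplanes. x \<in> hyperplane i \<and> y \<in> hyperplane i}
      = card {a\<in>V - {origin}. dot u a = \<zero>}"
    using card_hyperplanes_through[OF assms(1), of "\<lambda>a. dot u a = \<zero>"] by simp
  also have "\<dots> = card {a\<in>V. dot u a = \<zero>} - 1"
    using u(1) by (intro card_nonzero_orthogonal) simp
  finally have eq: "card {i\<in>hyperplanes. x \<in> hyperplane i \<and> y \<in> hyperplane i} = card {a\<in>V. dot u a = \<zero>} - 1" .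
  \<comment> \<open>The origin makes the count positive, so the truncated subtraction is
    exact.\<close>
  have "origin \<in> {a\<in>V. dot u a = \<zero>}" using u(1) by simp
  then have "card {a\<in>V. dot u a = \<zero>} > 0" by (subst card_gt_0_iff) auto
  then show ?thesis
    unfolding eq using card_hyperplane[OF u(1) uz, of \<zero>] by simp
qed

text \<open>The normals satisfy two linear equations, which may be dependent when the points are
  collinear; there may then be more of them.\<close>

lemma card_hyperplanes_3points_ge:
  assumes "x \<in> V" "y \<in> V" "w \<in> V"
  shows "order F ^ n \<le> order F ^ 2 *
    (card {i\<in>hyperplanes. x \<in> hyperplane i \<and> y \<in> hyperplane i \<and> w \<in> hyperplane i} + 1)"
proof -
  obtain u where u: "u \<in> V" "y = pt x u \<one>" using ex_direction[OF assms(1,2)] .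
  obtain v where v: "v \<in> V" "w = pt x v \<one>" using ex_direction[OF assms(1,3)] .
  have "{i\<in>hyperplanes. x \<in> hyperplane i \<and> y \<in> hyperplane i \<and> w \<in> hyperplane i}
      = {i\<in>hyperplanes. x \<in> hyperplane i \<and> dot u (fst i) = \<zero> \<and> dot v (fst i) = \<zero>}"
    unfolding u(2) v(2) using hyperplane_direction_iff[OF _ _ u(1)] hyperplane_direction_iff[OF _ _ v(1)] by blast
  then have "card {i\<in>hyperplanes. x \<in> hyperplane i \<and> y \<in> hyperplane i \<and> w \<in> hyperplane i}
      = card {a\<in>V - {origin}. dot u a = \<zero> \<and> dot v a = \<zero>}"
    using card_hyperplanes_through[OF assms(1), of "\<lambda>a. dot u a = \<zero> \<and> dot v a = \<zero>"] by simp
  also have "\<dots> = card {a\<in>V. dot u a = \<zero> \<and> dot v a = \<zero>} - 1"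
    using u(1) v(1) by (intro card_nonzero_orthogonal) simp
  finally have "card {a\<in>V. dot u a = \<zero> \<and> dot v a = \<zero>} \<le>
      card {i\<in>hyperplanes. x \<in> hyperplane i \<and> y \<in> hyperplane i \<and> w \<in> hyperplane i} + 1"
    by linarith
  then show ?thesis
    using card_double_kernel_ge[OF u(1) v(1)] by (meson le_trans mult_le_mono2)
qed

lemma line_of_subset_hyperplane_iff:
  assumes "i \<in> hyperplanes" "j \<in> lines"
  shows "line_of j \<subseteq> hyperplane i \<longleftrightarrow> fst j \<in> hyperplane i \<and> dot (fst i) (snd j) = \<zero>"
proof -
  have "fst i \<in> V" "snd i \<in> carrier F" "fst j \<in> V" "snd j \<in> V" using assms by auto
  from line_subset_hyperplane_iff[OF this] show ?thesis
    using \<open>fst j \<in> V\<close> by (simp add: line_of_def hyperplane_def)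
qed

lemma card_lines_in_hyperplane:
  assumes "i \<in> hyperplanes"
  shows "card {j\<in>lines. line_of j \<subseteq> hyperplane i}
    = card (hyperplane i) * card {v\<in>V - {origin}. dot (fst i) v = \<zero>}"
proof -
  have "{j\<in>lines. line_of j \<subseteq> hyperplane i}
      = {j\<in>lines. fst j \<in> hyperplane i \<and> dot (fst i) (snd j) = \<zero>}"
    using line_of_subset_hyperplane_iff[OF assms] by (intro Collect_cong) blast
  also have "\<dots> = hyperplane i \<times> {v\<in>V - {origin}. dot (fst i) v = \<zero>}"
    by (auto simp: hyperplane_def)
  finally show ?thesis by (simp add: card_cartesian_product)
qed

text \<open>Such a listing is a direction \<open>v\<close> in the hyperplane and a base point
  \<open>pt x v s\<close>, on whose line \<open>x\<close> has parameter
  \<open>\<ominus> s\<close>.\<close>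

lemma card_lines_in_hyperplane_through:
  assumes "i \<in> hyperplanes" "x \<in> hyperplane i"
  shows "card {j\<in>lines. line_of j \<subseteq> hyperplane i \<and> x \<in> line_of j}
    = order F * card {v\<in>V - {origin}. dot (fst i) v = \<zero>}"
proof -
  obtain a b where i: "i = (a, b)" "a \<in> V" "b \<in> carrier F" using assms(1) by auto
  have x: "x \<in> V" "dot a x = b" using assms(2) i by (auto simp: hyperplane_def)
  let ?D = "{v\<in>V - {origin}. dot a v = \<zero>}"
  let ?f = "\<lambda>(s, v). (pt x v s, v)"
  have "{j\<in>lines. line_of j \<subseteq> hyperplane i \<and> x \<in> line_of j} = ?f ` (carrier F \<times> ?D)"
  proof (intro equalityI subsetI)
    fix j assume "j \<in> {j\<in>lines. line_of j \<subseteq> hyperplane i \<and> x \<in> line_of j}"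
    then have j: "j \<in> lines" "line_of j \<subseteq> hyperplane i" "x \<in> line_of j" by auto
    obtain p v where pv: "j = (p, v)" "p \<in> V" "v \<in> V - {origin}" using j(1) by auto
    have v: "v \<in> ?D"
      using iffD1[OF line_of_subset_hyperplane_iff[OF assms(1) j(1)] j(2)] pv i(1) by simp
    obtain s where s: "s \<in> carrier F" "x = pt p v s" using j(3) pv by (auto simp: line_of_def line_def)
    have "p = pt x v (\<ominus> s)" unfolding s(2) using pv s(1) by (simp add: pt_pt_neg)
    then show "j \<in> ?f ` (carrier F \<times> ?D)"
      using v s(1) pv(1) by (intro image_eqI[of _ _ "(\<ominus> s, v)"]) auto
  next
    fix j assume "j \<in> ?f ` (carrier F \<times> ?D)"
    then obtain s v where j: "j = (pt x v s, v)" and sv: "s \<in> carrier F" "v \<in> V" "v \<noteq> origin" "dot a v = \<zero>" by auto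
    have jl: "j \<in> lines" using j sv x by simp
    have "pt (pt x v s) v (\<ominus> s) \<in> line (pt x v s) v" using sv by (auto simp: line_def)
    then have "x \<in> line_of j" using sv x by (simp add: line_of_def j pt_pt_neg)
    moreover have "fst j \<in> hyperplane i \<and> dot (fst i) (snd j) = \<zero>"
      using sv x i by (simp add: j hyperplane_def dot_pt)
    then have "line_of j \<subseteq> hyperplane i"
      using line_of_subset_hyperplane_iff[OF assms(1) jl] by blast
    ultimately show "j \<in> {j\<in>lines. line_of j \<subseteq> hyperplane i \<and> x \<in> line_of j}" using jl by simp
  qed
  moreover have "inj_on ?f (carrier F \<times> ?D)"
    using pt_inject_param[OF x(1)] by (auto intro!: inj_onI)
  ultimately show ?thesis
    using i(1) by (simp add: card_image card_cartesian_product order_def)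
qed

lemma order_ge_2: "order F \<ge> 2"
proof -
  have "card {\<zero>, \<one>} \<le> card (carrier F)"
    using finite_F by (intro card_mono) auto
  then show ?thesis by (simp add: order_def)
qed

lemma affine_3space:
  assumes "n = 3"
  shows "affine_3space V (order F) hyperplanes hyperplane lines line_of"
proof
  define q where "q = order F"
  have q2: "q \<ge> 2" using order_ge_2 by (simp add: q_def)
  have fF: "finite (carrier F)" "card (carrier F) = q" using finite_F by (simp_all add: q_def order_def)
  have card_V3: "card V = q ^ 3" using card_V assms by (simp add: q_def)
  then have card_Vz: "real (card (V - {origin})) = real q ^ 3 - 1"
    using q2 by (simp add: card_Diff_singleton of_nat_diff)
  have card_hyp: "card {x\<in>V. dot a x = b} = q ^ 2" if "a \<in> V - {origin}" "b \<in> carrier F" for a b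
    using card_hyperplane[of a b] that assms q2 by (simp add: q_def power3_eq_cube power2_eq_square)
  have card_dir: "real (card {v\<in>V - {origin}. dot (fst i) v = \<zero>}) = real q ^ 2 - 1" if "i \<in> hyperplanes" for i
  proof -
    have "fst i \<in> V - {origin}" using that by auto
    then show ?thesis
      using card_nonzero_orthogonal[of "\<lambda>v. dot (fst i) v = \<zero>"] card_hyp[of "fst i" \<zero>] q2
      by (simp add: of_nat_diff)
  qed
  show "order F \<ge> 2" by (rule order_ge_2)
  show "finite V" by simp
  show "card V = order F ^ 3" using card_V assms by simp
  show "finite hyperplanes" "finite lines" using fF by simp_all
  show "real (card hyperplanes) = real (order F) * (real (order F) ^ 3 - 1)"
    using card_Vz fF(2) by (simp add: card_cartesian_product q_def)
  fix x y w i j k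
  show "line_of j \<subseteq> V" if "j \<in> lines"
    using that by (simp add: line_of_def mem_Times_iff line_subset)
  show "card (line_of j) = order F" if "j \<in> lines"
    using that by (simp add: line_of_def mem_Times_iff card_line)
  show "line_of j = line_of k"
    if "j \<in> lines" "k \<in> lines" "x \<in> line_of j" "x \<in> line_of k" "y \<in> line_of j" "y \<in> line_of k" "x \<noteq> y"
    unfolding line_of_def by (rule line_eqI[of _ _ _ _ x y]) (use that in \<open>auto simp: line_of_def\<close>)
  show "line_of j \<subseteq> hyperplane i"
    if "i \<in> hyperplanes" "j \<in> lines" "x \<in> line_of j" "y \<in> line_of j" "x \<noteq> y" "x \<in> hyperplane i" "y \<in> hyperplane i"
    unfolding line_of_def hyperplane_def
    by (rule line_in_hyperplane[of _ _ _ _ x y]) (use that in \<open>auto simp: line_of_def hyperplane_def\<close>)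
  show "real (card {i\<in>hyperplanes. x \<in> hyperplane i}) = real (order F) ^ 3 - 1" if "x \<in> V"
    using card_hyperplanes_through[OF that, of "\<lambda>_. True"] card_Vz
    by (simp add: q_def set_diff_eq)
  show "real (card {i\<in>hyperplanes. x \<in> hyperplane i \<and> y \<in> hyperplane i}) = real (order F) ^ 2 - 1"
    if "x \<in> V" "y \<in> V" "x \<noteq> y"
  proof -
    have "q * (card {i\<in>hyperplanes. x \<in> hyperplane i \<and> y \<in> hyperplane i} + 1) = q * q ^ 2"
      using card_hyperplanes_2points[OF that] assms by (simp add: q_def power3_eq_cube power2_eq_square)
    then have "card {i\<in>hyperplanes. x \<in> hyperplane i \<and> y \<in> hyperplane i} + 1 = q ^ 2"
      using q2 by (subst (asm) mult_cancel_left) auto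
    then have "real (card {i\<in>hyperplanes. x \<in> hyperplane i \<and> y \<in> hyperplane i} + 1) = real (q ^ 2)"
      by (rule arg_cong)
    then show ?thesis by (simp add: q_def)
  qed
  show "real (card {i\<in>hyperplanes. x \<in> hyperplane i \<and> y \<in> hyperplane i \<and> w \<in> hyperplane i}) \<ge> real (order F) - 1"
    if "x \<in> V" "y \<in> V" "w \<in> V"
  proof -
    have "q ^ 2 * q \<le> q ^ 2 * (card {i\<in>hyperplanes. x \<in> hyperplane i \<and> y \<in> hyperplane i \<and> w \<in> hyperplane i} + 1)"
      using card_hyperplanes_3points_ge[OF that] assms by (simp add: q_def power3_eq_cube power2_eq_square)
    then have "q \<le> card {i\<in>hyperplanes. x \<in> hyperplane i \<and> y \<in> hyperplane i \<and> w \<in> hyperplane i} + 1"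
      using q2 by (subst (asm) mult_le_cancel1) auto
    then have "real q \<le> real (card {i\<in>hyperplanes. x \<in> hyperplane i \<and> y \<in> hyperplane i \<and> w \<in> hyperplane i} + 1)"
      by (rule of_nat_mono)
    then show ?thesis by (simp add: q_def)
  qed
  show "real (card {j\<in>lines. line_of j \<subseteq> hyperplane i}) = real (order F) ^ 2 * (real (order F) ^ 2 - 1)"
    if "i \<in> hyperplanes"
  proof -
    have "card (hyperplane i) = q ^ 2"
      unfolding hyperplane_def using that by (intro card_hyp) auto
    then show ?thesis
      using card_lines_in_hyperplane[OF that] card_dir[OF that] by (simp only: of_nat_mult of_nat_power q_def)
  qed
  show "real (card {j\<in>lines. line_of j \<subseteq> hyperplane i \<and> x \<in> line_of j}) = real (order F) * (real (order F) ^ 2 - 1)"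
    if "i \<in> hyperplanes" "x \<in> V" "x \<in> hyperplane i"
    using card_lines_in_hyperplane_through[OF that(1,3)] card_dir[OF that(1)]
    by (simp only: of_nat_mult q_def)
  show "real (card {j\<in>lines. x \<in> line_of j \<and> y \<in> line_of j}) = real (order F) * (real (order F) - 1)"
    if "x \<in> V" "y \<in> V" "x \<noteq> y"
  proof -
    have "{j\<in>lines. x \<in> line_of j \<and> y \<in> line_of j} = {(p, v) \<in> lines. x \<in> line p v \<and> y \<in> line p v}"
      by (auto simp: line_of_def)
    then show ?thesis
      using card_lines_2points[OF that] q2 by (simp add: q_def of_nat_diff)
  qed
qed

end

section \<open>The bound for Nikodym sets\<close>

text \<open>The complement of the set has a tangent at each of its points, so its density is at most
  \<open>31 / 50\<close>, and \<open>19 / 50\<close> remains.\<close>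

lemma card_nikodym_set_3_ge:
  assumes "field F" "finite (carrier F)" "order F \<ge> 10 ^ 8" "nikodym_set F 3 N"
  shows "real (card N) \<ge> 19 / 50 * real (order F) ^ 3"
proof -
  interpret field F by fact
  interpret finite_field_space F 3 by standard fact
  interpret G: affine_3space V "order F" hyperplanes hyperplane lines line_of
    by (rule affine_3space) simp
  define C where "C = V - N"
  have N: "N \<subseteq> V" using assms(4) by (simp add: nikodym_set_def V_def)
  \<comment> \<open>The line given by the Nikodym property at \<open>x\<close> has all its other
    points in \<open>N\<close>; as \<open>x\<close> is outside \<open>N\<close>, it meets
    \<open>C\<close> in \<open>x\<close> alone.\<close>
  have "\<exists>j\<in>lines. line_of j \<inter> C = {x}" if "x \<in> C" for x
  proof -
    have "x \<in> aff_space F 3" using that by (simp add: C_def V_def)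
    then obtain l where l: "is_line F 3 l" "x \<in> l" "l - {x} \<subseteq> N"
      using assms(4) unfolding nikodym_set_def by blast
    obtain a v where av: "a \<in> V" "v \<in> V" "v \<noteq> origin"
        "l = (\<lambda>t. vector_add F 3 a (vector_scale F 3 t v)) ` carrier F"
      using l(1) unfolding is_line_def V_def by blast
    have "line_of (a, v) = l" by (simp add: line_of_def line_def pt_def av(4))
    moreover have "l \<inter> C = {x}" using l that by (auto simp: C_def)
    moreover have "(a, v) \<in> lines" using av by simp
    ultimately show ?thesis by blast
  qed
  then obtain f where f: "\<And>x. x \<in> C \<Longrightarrow> f x \<in> lines" "\<And>x. x \<in> C \<Longrightarrow> line_of (f x) \<inter> C = {x}"
    by metis
  have "real (card C) \<le> 31 / 50 * real (order F) ^ 3"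
    using G.card_tangent_set_le[of C f] f assms(3) by (auto simp: C_def)
  moreover have "card V = card C + card N"
    unfolding C_def using N finite_subset[OF N] by (simp add: card_Diff_subset card_mono)
  then have "real (order F) ^ 3 = real (card C) + real (card N)"
    by (simp add: G.card_V flip: of_nat_power of_nat_add)
  ultimately show ?thesis by simp
qed

theorem theorem2:
  "\<exists>q0::nat. \<forall>q\<ge>q0. \<forall>(F :: 'a ring) (N :: (nat \<Rightarrow> 'a) set).
     field F \<and> finite (carrier F) \<and> order F = q \<and> nikodym_set F 3 N \<longrightarrow>
     real (card N) \<ge> 0.38 * real q ^ 3"
\<comment> \<open>The threshold is the one required by \<open>card_tangent_set_le\<close>; it
  depends on neither the field nor its element type.\<close>
proof (intro exI[of _ "10 ^ 8"] allI impI)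
  fix q :: nat and F :: "'a ring" and N :: "(nat \<Rightarrow> 'a) set"
  assume "q \<ge> 10 ^ 8" and "field F \<and> finite (carrier F) \<and> order F = q \<and> nikodym_set F 3 N"
  then show "real (card N) \<ge> 0.38 * real q ^ 3"
    using card_nikodym_set_3_ge[of F N] by simp
qed

end
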